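(* Let $n\ge 2$, let $P=(p_1,\dots,p_n)$ and $Q=(q_1,\dots,q_n)$ be elements of $\Gamma_n$, and let $r,R$ be real numbers with $0<r\le \frac{p_i}{q_i}\le R<\infty$ for all $i\in\{1,\dots,n\}$. Then $$\frac{2r(r+3)}{r+1}\,I(P\|Q)\le D(P\|Q)\le \frac{2R(R+3)}{R+1}\,I(P\|Q).$$
   Context: $\Gamma_n=\{P=(p_1,\dots,p_n): p_i>0,\ \sum_{i=1}^n p_i=1\}$ is the set of finite discrete probability distributions with strictly positive entries. $\ln$ is the natural logarithm. The relative J-divergence is $D(P\|Q)=\sum_{i=1}^n (p_i-q_i)\ln\left(\frac{p_i+q_i}{2q_i}\right)$. The Jensen-Shannon divergence is $I(P\|Q)=\frac12\left[\sum_{i=1}^n p_i\ln\left(\frac{2p_i}{p_i+q_i}\right)+\sum_{i=1}^n q_i\ln\left(\frac{2q_i}{p_i+q_i}\right)\right]$. *)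

theory Defs
  imports Complex_Main
begin

text \<open>An \<open>n\<close>-tuple \<open>(p\<^sub>1, \<dots>, p\<^sub>n)\<close> is represented by a function on \<open>nat\<close> of which only
  the values on \<open>{1..n}\<close> matter; values outside that range are unconstrained.\<close>

definition prob_dists :: "nat \<Rightarrow> (nat \<Rightarrow> real) set"  (\<open>\<Gamma>\<close>) where
  "\<Gamma> n = {p. (\<forall>i\<in>{1..n}. p i > 0) \<and> (\<Sum>i=1..n. p i) = 1}"

definition relative_J_divergence :: "nat \<Rightarrow> (nat \<Rightarrow> real) \<Rightarrow> (nat \<Rightarrow> real) \<Rightarrow> real" where
  "relative_J_divergence n p q = (\<Sum>i=1..n. (p i - q i) * ln ((p i + q i) / (2 * q i)))"

definition Jensen_Shannon_divergence :: "nat \<Rightarrow> (nat \<Rightarrow> real) \<Rightarrow> (nat \<Rightarrow> real) \<Rightarrow> real" where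
  "Jensen_Shannon_divergence n p q =
     (1 / 2) * ((\<Sum>i=1..n. p i * ln (2 * p i / (p i + q i)))
              + (\<Sum>i=1..n. q i * ln (2 * q i / (p i + q i))))"

end

theory Submission
  imports Defs "HOL-Analysis.Convex"
begin

text \<open>Both divergences are Csiszar divergences \<open>\<Sum>i. q\<^sub>i f (p\<^sub>i / q\<^sub>i)\<close> whose generator
  vanishes to second order at \<open>1\<close>. The second derivatives of the generators are
  \<open>(x + 3) / (x + 1)\<^sup>2\<close> and \<open>1 / (2x(x + 1))\<close>, and their quotient \<open>2x(x + 3) / (x + 1)\<close> is
  increasing in \<open>x\<close>. Since \<open>r \<le> 1 \<le> R\<close> is forced by normalisation, comparing the second derivatives
  on \<open>[r, R]\<close> and integrating twice from \<open>1\<close> compares the generators pointwise.\<close>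

definition rel_J_gen :: "real \<Rightarrow> real" where
  "rel_J_gen x = (x - 1) * ln ((x + 1) / 2)"

definition JS_gen :: "real \<Rightarrow> real" where
  "JS_gen x = (x * ln (2 * x / (x + 1)) + ln (2 / (x + 1))) / 2"

lemma relative_J_divergence_eq:
  assumes "\<And>i. i \<in> {1..n} \<Longrightarrow> q i > 0"
  shows "relative_J_divergence n p q = (\<Sum>i=1..n. q i * rel_J_gen (p i / q i))"
  unfolding relative_J_divergence_def
proof (rule sum.cong)
  fix i assume "i \<in> {1..n}"
  then have q: "q i > 0" using assms by blast
  then have "(p i / q i + 1) / 2 = (p i + q i) / (2 * q i)" "q i * (p i / q i - 1) = p i - q i"
    by (simp_all add: add_divide_distrib right_diff_distrib)
  then have "(p i - q i) * ln ((p i + q i) / (2 * q i))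
      = q i * (p i / q i - 1) * ln ((p i / q i + 1) / 2)"
    by (simp only:)
  then show "(p i - q i) * ln ((p i + q i) / (2 * q i)) = q i * rel_J_gen (p i / q i)"
    by (simp only: rel_J_gen_def mult.assoc)
qed simp

lemma Jensen_Shannon_divergence_eq:
  assumes "\<And>i. i \<in> {1..n} \<Longrightarrow> q i > 0"
  shows "Jensen_Shannon_divergence n p q = (\<Sum>i=1..n. q i * JS_gen (p i / q i))"
  unfolding Jensen_Shannon_divergence_def sum.distrib [symmetric] sum_distrib_left
proof (rule sum.cong)
  fix i assume "i \<in> {1..n}"
  then have q: "q i > 0" using assms by blast
  \<comment> \<open>Over the common denominator \<open>q i\<close>, the factor \<open>q i\<close>
    cancels in both logarithm arguments of \<open>JS_gen\<close>.\<close>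
  then have sum: "p i / q i + 1 = (p i + q i) / q i"
    by (simp add: field_simps)
  have "2 * (p i / q i) / (p i / q i + 1) = 2 * p i / (p i + q i)"
       "2 / (p i / q i + 1) = 2 * q i / (p i + q i)"
    unfolding sum using q by simp_all
  then show "1 / 2 * (p i * ln (2 * p i / (p i + q i)) + q i * ln (2 * q i / (p i + q i)))
      = q i * JS_gen (p i / q i)"
    using q by (simp add: JS_gen_def field_simps)
qed simp

lemma ln_half_has_derivative:
  assumes "x > 0"
  shows "((\<lambda>x. ln ((x + 1) / 2)) has_real_derivative 1 / (x + 1)) (at x)"
  using assms by (auto intro!: derivative_eq_intros simp: divide_simps)

lemma rel_J_gen_has_derivative:
  assumes "x > 0"
  shows "(rel_J_gen has_real_derivative ln ((x + 1) / 2) + (x - 1) / (x + 1)) (at x)"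
  unfolding rel_J_gen_def using assms
  by (auto intro!: derivative_eq_intros ln_half_has_derivative simp: divide_simps)
    (simp add: algebra_simps)

lemma rel_J_gen_has_second_derivative:
  assumes "x > 0"
  shows "((\<lambda>x. ln ((x + 1) / 2) + (x - 1) / (x + 1)) has_real_derivative
           (x + 3) / (x + 1)\<^sup>2) (at x)"
proof -
  have "((\<lambda>x. (x - 1) / (x + 1)) has_real_derivative 2 / (x + 1)\<^sup>2) (at x)"
    using assms by (auto intro!: derivative_eq_intros simp: power2_eq_square)
  from DERIV_add [OF ln_half_has_derivative [OF assms] this] show ?thesis
    by (rule DERIV_cong) (use assms in \<open>simp add: divide_simps power2_eq_square\<close>)
qed

text \<open>Differentiating the first logarithm contributes \<open>1 / (x + 1)\<close> and the
  second \<open>- 1 / (x + 1)\<close>; these cancel, so only a logarithm survives.\<close>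

lemma JS_gen_has_derivative:
  assumes "x > 0"
  shows "(JS_gen has_real_derivative ln (2 * x / (x + 1)) / 2) (at x)"
  unfolding JS_gen_def using assms
  by (auto intro!: derivative_eq_intros simp: divide_simps power2_eq_square)

lemma JS_gen_has_second_derivative:
  assumes "x > 0"
  shows "((\<lambda>x. ln (2 * x / (x + 1)) / 2) has_real_derivative 1 / (2 * x * (x + 1))) (at x)"
  using assms
  by (auto intro!: derivative_eq_intros simp: divide_simps power2_eq_square)
    (simp add: algebra_simps)

text \<open>A nonnegative second derivative makes the combination convex on \<open>{r..R}\<close>,
  so it lies above its tangent at 1, which is the zero line. The signs of \<open>a\<close> and
  \<open>b\<close> are left free so that both the lower and the upper bound are instances.\<close>

lemma generator_combination_nonneg:
  assumes "0 < r" "r \<le> 1" "1 \<le> R" and x: "x \<in> {r..R}"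
    and snd: "\<And>y. y \<in> {r..R} \<Longrightarrow> 0 \<le> a * ((y + 3) / (y + 1)\<^sup>2) + b * (1 / (2 * y * (y + 1)))"
  shows "0 \<le> a * rel_J_gen x + b * JS_gen x"
proof -
  let ?g = "\<lambda>y. a * rel_J_gen y + b * JS_gen y"
  let ?g' = "\<lambda>y. a * (ln ((y + 1) / 2) + (y - 1) / (y + 1)) + b * (ln (2 * y / (y + 1)) / 2)"
  let ?g'' = "\<lambda>y. a * ((y + 3) / (y + 1)\<^sup>2) + b * (1 / (2 * y * (y + 1)))"
  \<comment> \<open>Tangent inequality at 1, a point of \<open>{r..R}\<close> because
    \<open>r \<le> 1 \<le> R\<close>.\<close>
  have "?g' 1 * (x - 1) \<le> ?g x - ?g 1"
  proof (rule f''_imp_f' [where C = "{r..R}" and f = ?g and f' = ?g' and f'' = ?g''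
        and x = 1 and y = x])
    fix y assume "y \<in> {r..R}"
    with \<open>0 < r\<close> have y: "y > 0" by simp
    show "(?g has_real_derivative ?g' y) (at y)"
      by (intro DERIV_add DERIV_cmult rel_J_gen_has_derivative JS_gen_has_derivative y)
    show "(?g' has_real_derivative ?g'' y) (at y)"
      by (intro DERIV_add DERIV_cmult rel_J_gen_has_second_derivative
          JS_gen_has_second_derivative y)
  qed (use assms in simp_all)
  \<comment> \<open>\<open>?g 1\<close> and \<open>?g' 1\<close> both vanish, since every logarithm
    becomes \<open>ln 1\<close>.\<close>
  then show ?thesis by (simp add: rel_J_gen_def JS_gen_def)
qed

lemma second_derivative_ratio_mono:
  fixes x y :: real
  assumes "0 < x" "x \<le> y"
  shows "2 * x * (x + 3) / (x + 1) \<le> 2 * y * (y + 3) / (y + 1)"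
proof -
  \<comment> \<open>The cross-multiplied difference factors into \<open>y - x\<close> times a
    positive polynomial.\<close>
  have "2 * y * (y + 3) * (x + 1) - 2 * x * (x + 3) * (y + 1) = 2 * (y - x) * (x * y + x + y + 3)"
    by (simp add: algebra_simps)
  also have "\<dots> \<ge> 0" using assms by simp
  finally show ?thesis using assms by (simp add: frac_le_eq divide_nonpos_pos)
qed

text \<open>Exposes the second derivative of \<open>JS_gen\<close> as a positive common factor, so
  that comparing second derivatives reduces to monotonicity of the ratio.\<close>

lemma second_derivative_ratio:
  fixes x :: real
  assumes "x > 0"
  shows "(x + 3) / (x + 1)\<^sup>2 = 2 * x * (x + 3) / (x + 1) * (1 / (2 * x * (x + 1)))"
  using assms by (simp add: power2_eq_square)

text \<open>The constant is the value of the increasing ratio at \<open>r\<close>, its minimum on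
  \<open>{r..R}\<close>.\<close>

lemma rel_J_gen_ge_JS_gen:
  assumes "0 < r" "r \<le> 1" "1 \<le> R" "x \<in> {r..R}"
  shows "2 * r * (r + 3) / (r + 1) * JS_gen x \<le> rel_J_gen x"
proof -
  have "0 \<le> 1 * rel_J_gen x + (- (2 * r * (r + 3) / (r + 1))) * JS_gen x"
  proof (rule generator_combination_nonneg [OF assms])
    fix y assume "y \<in> {r..R}"
    with \<open>0 < r\<close> have y: "y > 0" "r \<le> y" by auto
    have "2 * r * (r + 3) / (r + 1) * (1 / (2 * y * (y + 1))) \<le> (y + 3) / (y + 1)\<^sup>2"
      unfolding second_derivative_ratio [OF y(1)] using \<open>0 < r\<close> y
      by (intro mult_right_mono second_derivative_ratio_mono) auto
    then show "0 \<le> 1 * ((y + 3) / (y + 1)\<^sup>2)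
        + - (2 * r * (r + 3) / (r + 1)) * (1 / (2 * y * (y + 1)))"
      by linarith
  qed
  then show ?thesis by linarith
qed

text \<open>Here the constant is the maximum of the ratio, attained at \<open>R\<close>, and the
  signs of the combination are reversed.\<close>

lemma rel_J_gen_le_JS_gen:
  assumes "0 < r" "r \<le> 1" "1 \<le> R" "x \<in> {r..R}"
  shows "rel_J_gen x \<le> 2 * R * (R + 3) / (R + 1) * JS_gen x"
proof -
  have "0 \<le> (- 1) * rel_J_gen x + 2 * R * (R + 3) / (R + 1) * JS_gen x"
  proof (rule generator_combination_nonneg [OF assms])
    fix y assume "y \<in> {r..R}"
    with \<open>0 < r\<close> have y: "y > 0" "y \<le> R" by auto
    have "(y + 3) / (y + 1)\<^sup>2 \<le> 2 * R * (R + 3) / (R + 1) * (1 / (2 * y * (y + 1)))"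
      unfolding second_derivative_ratio [OF y(1)] using y
      by (intro mult_right_mono second_derivative_ratio_mono) auto
    then show "0 \<le> - 1 * ((y + 3) / (y + 1)\<^sup>2)
        + 2 * R * (R + 3) / (R + 1) * (1 / (2 * y * (y + 1)))"
      by linarith
  qed
  then show ?thesis by linarith
qed

theorem proposition4p3:
  fixes n :: nat and P Q :: "nat \<Rightarrow> real" and r R :: real
  assumes "n \<ge> 2"
    and "P \<in> \<Gamma> n" and "Q \<in> \<Gamma> n"
    and "0 < r"
    and "\<And>i. i \<in> {1..n} \<Longrightarrow> r \<le> P i / Q i \<and> P i / Q i \<le> R"
  shows "2 * r * (r + 3) / (r + 1) * Jensen_Shannon_divergence n P Q
           \<le> relative_J_divergence n P Q
       \<and> relative_J_divergence n P Q
           \<le> 2 * R * (R + 3) / (R + 1) * Jensen_Shannon_divergence n P Q"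
proof -
  have Q: "Q i > 0" if "i \<in> {1..n}" for i
    using assms(3) that by (simp add: prob_dists_def)
  have sums: "(\<Sum>i=1..n. P i) = 1" "(\<Sum>i=1..n. Q i) = 1"
    using assms(2,3) by (simp_all add: prob_dists_def)
  have bounds: "r * Q i \<le> P i \<and> P i \<le> R * Q i" if "i \<in> {1..n}" for i
    using assms(5) [OF that] Q [OF that] by (simp add: pos_le_divide_eq pos_divide_le_eq)
  \<comment> \<open>Both total masses are 1, so summing the pointwise bounds places 1 between
    \<open>r\<close> and \<open>R\<close>.\<close>
  have "(\<Sum>i=1..n. r * Q i) \<le> (\<Sum>i=1..n. P i)" "(\<Sum>i=1..n. P i) \<le> (\<Sum>i=1..n. R * Q i)"
    using bounds by (auto intro!: sum_mono)
  then have "r \<le> 1" "1 \<le> R"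
    by (simp_all only: sum_distrib_left [symmetric] sums mult_1_right)
  note gen = rel_J_gen_ge_JS_gen [OF assms(4) this] rel_J_gen_le_JS_gen [OF assms(4) this]
  \<comment> \<open>Moving the constant next to the generator lets the sums be compared term by term
    with weights \<open>Q i\<close>.\<close>
  have scale: "c * (\<Sum>i=1..n. Q i * JS_gen (P i / Q i))
      = (\<Sum>i=1..n. Q i * (c * JS_gen (P i / Q i)))" for c
    by (simp add: sum_distrib_left mult.left_commute)
  have D: "relative_J_divergence n P Q = (\<Sum>i=1..n. Q i * rel_J_gen (P i / Q i))"
    by (intro relative_J_divergence_eq Q)
  have I: "Jensen_Shannon_divergence n P Q = (\<Sum>i=1..n. Q i * JS_gen (P i / Q i))"
    by (intro Jensen_Shannon_divergence_eq Q)
  show ?thesis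
    unfolding D I scale
    using assms(5) by (intro conjI sum_mono mult_left_mono gen less_imp_le [OF Q]) auto
qed

end
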